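(* Let $X$ be a compact metric space. If the group $H(X,X)$ of all self-homeomorphisms of $X$ is countable, then $(H(X,X),F_T)$ has topological entropy zero for every $T\in H(X,X)$.
   Context: For a compact metric space $(X,d)$, $H(X,X)$ carries the uniform metric $\varrho(\varphi,\psi)=\sup_{x\in X}d(\varphi(x),\psi(x))$. For $T\in H(X,X)$, $F_T:H(X,X)\to H(X,X)$ is $F_T(\varphi)=T\circ\varphi$ (a uniformly continuous map). Topological entropy of a uniformly continuous map $S:Z\to Z$ of a (not necessarily compact) metric space $(Z,\varrho)$: for $n\ge1$ let $\varrho_n(x,y)=\max_{0\le j\le n-1}\varrho(S^jx,S^jy)$; for compact $K\subset Z$ and $\epsilon>0$ let $\mathrm{sep}(n,\epsilon;K)$ be the maximal cardinality of a set $E\subset K$ with $\varrho_n(x,y)>\epsilon$ for all distinct $x,y\in E$. Then $h_{\mathrm{top}}(S,K)=\lim_{\epsilon\to0}\limsup_{n\to\infty}\frac1n\log\mathrm{sep}(n,\epsilon;K)$ and $h_{\mathrm{top}}(S)=\sup_K h_{\mathrm{top}}(S,K)$ over all compact $K\subset Z$. *)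

theory Defs
  imports "HOL-Analysis.Analysis"
begin

text \<open>Homeomorphisms are taken to be extensional outside the carrier (as in \<^const>\<open>cfunspace\<close>), so
  that equal maps on the carrier are equal as functions; the metric inherited from
  \<^const>\<open>cfunspace\<close> is the supremum metric.\<close>

definition homeo_space :: "'a metric \<Rightarrow> ('a \<Rightarrow> 'a) metric"
  where "homeo_space X =
    submetric (cfunspace (mtopology_of X) X) {f. homeomorphic_map (mtopology_of X) (mtopology_of X) f}"

definition left_comp :: "'a metric \<Rightarrow> ('a \<Rightarrow> 'a) \<Rightarrow> ('a \<Rightarrow> 'a) \<Rightarrow> ('a \<Rightarrow> 'a)"
  where "left_comp X T \<phi> = compose (mspace X) T \<phi>"

lemma mdist_homeo_space:
  assumes "\<phi> \<in> mspace (homeo_space X)" "\<psi> \<in> mspace (homeo_space X)" "mspace X \<noteq> {}"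
  shows "mdist (homeo_space X) \<phi> \<psi> = (SUP x\<in>mspace X. mdist X (\<phi> x) (\<psi> x))"
proof -
  have "\<phi> \<in> mspace (funspace (mspace X) X)" "\<psi> \<in> mspace (funspace (mspace X) X)"
    using assms cfunspace_subset_funspace[of "mtopology_of X" X]
    by (auto simp: homeo_space_def simp del: mspace_cfunspace mspace_funspace)
  then show ?thesis
    using assms(3) by (simp add: homeo_space_def mdist_cfunspace_eq_mdist_funspace
        Metric_space.fdist_def[OF Metric_space_mspace_mdist])
qed

lemma mspace_homeo_space:
  assumes "compact_space (mtopology_of X)"
  shows "mspace (homeo_space X) =
    {f \<in> extensional (mspace X). homeomorphic_map (mtopology_of X) (mtopology_of X) f}"
proof -
  interpret Metric_space "mspace X" "mdist X" by (rule Metric_space_mspace_mdist)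
  have "mbounded (f ` mspace X)" if "homeomorphic_map (mtopology_of X) (mtopology_of X) f" for f
  proof -
    have "compactin mtopology (mspace X)"
      using assms by (simp add: compact_space_def mtopology_of_def)
    then show ?thesis
      using homeomorphic_imp_surjective_map[OF that] compactin_imp_mbounded by simp
  qed
  moreover have "f \<in> mspace X \<rightarrow> mspace X"
    if "homeomorphic_map (mtopology_of X) (mtopology_of X) f" for f
    using homeomorphic_imp_surjective_map[OF that] by auto
  ultimately show ?thesis
    using homeomorphic_imp_continuous_map unfolding homeo_space_def mspace_submetric mspace_cfunspace
      topspace_mtopology_of by blast
qed

lemma uniformly_continuous_left_comp:
  assumes X: "compact_space (mtopology_of X)" and T: "T \<in> mspace (homeo_space X)"
  shows "uniformly_continuous_map (homeo_space X) (homeo_space X) (left_comp X T)"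
proof -
  let ?T = "mtopology_of X"
  have hT: "homeomorphic_map ?T ?T T"
    using T by (simp add: mspace_homeo_space[OF X])
  have in_H: "left_comp X T \<phi> \<in> mspace (homeo_space X)" if "\<phi> \<in> mspace (homeo_space X)" for \<phi>
  proof -
    have "homeomorphic_map ?T ?T (T \<circ> \<phi>)"
      using that by (intro homeomorphic_map_compose[OF _ hT]) (simp add: mspace_homeo_space[OF X])
    then have "homeomorphic_map ?T ?T (left_comp X T \<phi>)"
      by (rule homeomorphic_map_eq) (simp add: left_comp_def compose_def)
    then show ?thesis
      by (simp add: mspace_homeo_space[OF X] left_comp_def)
  qed
  have uT: "uniformly_continuous_map X X T"
    using homeomorphic_imp_continuous_map[OF hT] by (simp add: continuous_eq_uniformly_continuous_map[OF X])
  have in_X: "\<phi> x \<in> mspace X" if "\<phi> \<in> mspace (homeo_space X)" "x \<in> mspace X" for \<phi> x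
    using that by (auto simp: homeo_space_def)
  have cf: "\<phi> \<in> mspace (cfunspace ?T X)" if "\<phi> \<in> mspace (homeo_space X)" for \<phi>
    using that by (simp add: homeo_space_def)
  have md: "mdist (homeo_space X) = mdist (cfunspace ?T X)"
    by (simp add: homeo_space_def)
  show ?thesis
    unfolding uniformly_continuous_map_def
  proof (intro conjI allI impI)
    show "left_comp X T \<in> mspace (homeo_space X) \<rightarrow> mspace (homeo_space X)"
      using in_H by blast
    fix e :: real assume "0 < e"
    then have "0 < e/2" by simp
    then obtain d where d: "0 < d"
      "\<And>x y. x \<in> mspace X \<Longrightarrow> y \<in> mspace X \<Longrightarrow> mdist X y x < d \<Longrightarrow> mdist X (T y) (T x) < e/2"
      using uT unfolding uniformly_continuous_map_def by meson
    have "mdist (homeo_space X) (left_comp X T \<psi>) (left_comp X T \<phi>) < e"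
      if H: "\<phi> \<in> mspace (homeo_space X)" "\<psi> \<in> mspace (homeo_space X)"
        and lt: "mdist (homeo_space X) \<psi> \<phi> < d" for \<phi> \<psi>
    proof -
      have "mdist X (left_comp X T \<psi> x) (left_comp X T \<phi> x) \<le> e/2" if x: "x \<in> topspace ?T" for x
      proof -
        have "mdist X (\<psi> x) (\<phi> x) < d"
          using mdist_cfunspace_imp_mdist_le[OF cf[OF H(2)] cf[OF H(1)] order_refl x] lt md by simp
        then show ?thesis
          using d(2)[of "\<phi> x" "\<psi> x"] in_X H x by (simp add: left_comp_def compose_def)
      qed
      then have "mdist (cfunspace ?T X) (left_comp X T \<psi>) (left_comp X T \<phi>) \<le> e/2"
        using \<open>0 < e/2\<close> by (intro mdist_cfunspace_le) auto
      then show ?thesis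
        using md \<open>0 < e\<close> by simp
    qed
    with d(1) show "\<exists>d>0. \<forall>\<phi>\<in>mspace (homeo_space X). \<forall>\<psi>\<in>mspace (homeo_space X).
        mdist (homeo_space X) \<psi> \<phi> < d \<longrightarrow> mdist (homeo_space X) (left_comp X T \<psi>) (left_comp X T \<phi>) < e"
      by blast
  qed
qed

definition dyn_dist :: "'a metric \<Rightarrow> ('a \<Rightarrow> 'a) \<Rightarrow> nat \<Rightarrow> 'a \<Rightarrow> 'a \<Rightarrow> real"
  where "dyn_dist Z S n x y = (MAX j\<in>{0..n - 1}. mdist Z ((S ^^ j) x) ((S ^^ j) y))"

definition dyn_separated :: "'a metric \<Rightarrow> ('a \<Rightarrow> 'a) \<Rightarrow> nat \<Rightarrow> real \<Rightarrow> 'a set \<Rightarrow> bool"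
  where "dyn_separated Z S n \<epsilon> E \<longleftrightarrow> (\<forall>x\<in>E. \<forall>y\<in>E. x \<noteq> y \<longrightarrow> dyn_dist Z S n x y > \<epsilon>)"

text \<open>The maximum exists, and restricting to finite sets loses nothing, when \<open>K\<close> is compact and
  \<open>S\<close> is continuous: see \<open>dyn_separated_bounded\<close> below.\<close>

definition sep :: "'a metric \<Rightarrow> ('a \<Rightarrow> 'a) \<Rightarrow> nat \<Rightarrow> real \<Rightarrow> 'a set \<Rightarrow> nat"
  where "sep Z S n \<epsilon> K = Max {card E |E. finite E \<and> E \<subseteq> K \<and> dyn_separated Z S n \<epsilon> E}"

text \<open>The inner expression is antitone in \<open>\<epsilon> > 0\<close>, so the limit exists in the extended reals.
  As \<^term>\<open>ln (0::real) = 0\<close>, the empty set has entropy 0 and does not affect the supremum below.\<close>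

definition top_entropy_on :: "'a metric \<Rightarrow> ('a \<Rightarrow> 'a) \<Rightarrow> 'a set \<Rightarrow> ereal"
  where "top_entropy_on Z S K =
    Lim (at_right 0) (\<lambda>\<epsilon>. limsup (\<lambda>n. ereal (1 / real n * ln (real (sep Z S n \<epsilon> K)))))"

definition top_entropy :: "'a metric \<Rightarrow> ('a \<Rightarrow> 'a) \<Rightarrow> ereal"
  where "top_entropy Z S = (SUP K\<in>{K. compactin (mtopology_of Z) K}. top_entropy_on Z S K)"

lemma dyn_separated_bounded:
  assumes cS: "continuous_map (mtopology_of Z) (mtopology_of Z) S" and K: "compactin (mtopology_of Z) K"
    and "0 < \<epsilon>"
  shows "\<exists>N. \<forall>E. E \<subseteq> K \<and> dyn_separated Z S n \<epsilon> E \<longrightarrow> finite E \<and> card E \<le> N"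
proof -
  let ?T = "mtopology_of Z"
  let ?U = "\<lambda>x. {y \<in> topspace ?T. \<forall>j\<in>{0..n - 1}. (S ^^ j) y \<in> Metric_space.mball (mspace Z) (mdist Z) ((S ^^ j) x) (\<epsilon>/2)}"
  interpret Metric_space "mspace Z" "mdist Z" by (rule Metric_space_mspace_mdist)
  have KZ: "K \<subseteq> mspace Z"
    using compactin_subset_topspace[OF K] by simp
  have cont: "continuous_map ?T ?T (S ^^ j)" for j
  proof (induction j)
    case (Suc j)
    then show ?case
      using continuous_map_compose[OF Suc cS] by (simp add: o_def)
  qed (auto simp: id_def[symmetric])
  have S_in: "(S ^^ j) x \<in> mspace Z" if "x \<in> mspace Z" for j x
    using continuous_map_image_subset_topspace[OF cont[of j]] that by auto
  have op: "openin ?T (?U x)" for x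
  proof -
    have "?U x = (\<Inter>j\<in>{0..n - 1}. {y \<in> topspace ?T. (S ^^ j) y \<in> mball ((S ^^ j) x) (\<epsilon>/2)})"
      by auto
    moreover have "openin ?T {y \<in> topspace ?T. (S ^^ j) y \<in> mball ((S ^^ j) x) (\<epsilon>/2)}" for j
      by (intro openin_continuous_map_preimage[OF cont]) (simp add: mtopology_of_def openin_mball)
    ultimately show ?thesis
      by auto
  qed
  have "K \<subseteq> \<Union> (?U ` K)"
    using KZ S_in \<open>0 < \<epsilon>\<close> by fastforce
  then obtain F where F: "finite F" "F \<subseteq> ?U ` K" "K \<subseteq> \<Union> F"
    using compactinD[OF K, of "?U ` K"] op by (smt (verit, best) imageE)
  show ?thesis
  proof (intro exI[of _ "card F"] allI impI)
    fix E assume E: "E \<subseteq> K \<and> dyn_separated Z S n \<epsilon> E"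
    have "\<forall>x\<in>E. \<exists>V. V \<in> F \<and> x \<in> V"
      using E F by blast
    then obtain g where g: "\<And>x. x \<in> E \<Longrightarrow> g x \<in> F \<and> x \<in> g x"
      by metis
    have "inj_on g E"
    proof (rule inj_onI, rule ccontr)
      fix x y assume xy: "x \<in> E" "y \<in> E" "g x = g y" "x \<noteq> y"
      obtain z where z: "z \<in> K" "g x = ?U z"
        using g[OF xy(1)] F by blast
      have mem: "x \<in> ?U z" "y \<in> ?U z"
        using g xy z by blast+
      have "mdist Z ((S ^^ j) x) ((S ^^ j) y) \<le> \<epsilon>" if j: "j \<in> {0..n - 1}" for j
      proof -
        have "(S ^^ j) x \<in> mball ((S ^^ j) z) (\<epsilon>/2)" "(S ^^ j) y \<in> mball ((S ^^ j) z) (\<epsilon>/2)"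
          using mem j by blast+
        then show ?thesis
          using triangle'[of "(S ^^ j) x" "(S ^^ j) z" "(S ^^ j) y"]
          by (auto simp: commute)
      qed
      then have "dyn_dist Z S n x y \<le> \<epsilon>"
        unfolding dyn_dist_def by (subst Max_le_iff) auto
      then show False
        using E xy unfolding dyn_separated_def by (meson not_le)
    qed
    moreover have "g ` E \<subseteq> F"
      using g by blast
    ultimately show "finite E \<and> card E \<le> card F"
      using F(1) by (meson card_inj_on_le inj_on_finite)
  qed
qed

end

theory Submission
  imports Defs
begin

text \<open>With the metric \<open>\<rho>(\<phi>, \<psi>) + \<rho>(\<phi>\<inverse>, \<psi>\<inverse>)\<close> the homeomorphism group is complete, so if it is countable
  it has an isolated point, as a nonempty perfect complete metric space is uncountable. Since \<open>\<rho>\<close> is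
  invariant under right translations and left translations are uniformly continuous, isolation of
  one point makes the group uniformly discrete for \<open>\<rho>\<close> itself. Compact sets are then finite, and the
  number of separated points in a finite set does not grow with time.\<close>

section \<open>Isolated points and discreteness in metric spaces\<close>

text \<open>If no point is isolated, the space equals its own derived set; a nonempty complete
  perfect space admits an injection from the reals, contradicting countability.\<close>

lemma (in Metric_space) countable_mcomplete_isolated_point:
  assumes "mcomplete" "countable M" "M \<noteq> {}"
  shows "\<exists>x\<in>M. \<exists>r>0. \<forall>y\<in>M. d x y < r \<longrightarrow> y = x"
proof (rule ccontr)
  assume no: "\<not> ?thesis"
  have "mtopology derived_set_of M = M"
  proof
    show "mtopology derived_set_of M \<subseteq> M"
      using derived_set_of_subset_topspace[of mtopology M] by simp
    show "M \<subseteq> mtopology derived_set_of M"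
    proof
      fix x assume x: "x \<in> M"
      have "\<exists>y. y \<noteq> x \<and> y \<in> M \<and> y \<in> U" if U: "x \<in> U" "openin mtopology U" for U
      proof -
        obtain r where r: "0 < r" "mball x r \<subseteq> U"
          using U by (auto simp: openin_mtopology)
        with no x show ?thesis
          by (metis in_mball subsetD)
      qed
      then show "x \<in> mtopology derived_set_of M"
        using x by (auto simp: in_derived_set_of)
    qed
  qed
  then have "(UNIV :: real set) \<lesssim> M"
    using lepoll_perfect_set assms by blast
  then show False
    using assms(2) countable_lepoll uncountable_UNIV_real by blast
qed

text \<open>A ball of radius \<open>r\<close> contains only its centre, so \<open>K\<close> has no
  limit points, and a compact set disjoint from its derived set is finite.\<close>

lemma compactin_uniformly_discrete_imp_finite:
  assumes K: "compactin (mtopology_of Z) K" and "0 < r"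
    and disc: "\<And>x y. \<lbrakk>x \<in> mspace Z; y \<in> mspace Z; mdist Z x y < r\<rbrakk> \<Longrightarrow> x = y"
  shows "finite K"
proof -
  interpret Metric_space "mspace Z" "mdist Z" by (rule Metric_space_mspace_mdist)
  have "K \<inter> mtopology derived_set_of K = {}"
  proof (rule ccontr)
    assume "K \<inter> mtopology derived_set_of K \<noteq> {}"
    then obtain x where x: "x \<in> mspace Z" "x \<in> mtopology derived_set_of K"
      by (auto simp: in_derived_set_of)
    then obtain y where "y \<noteq> x" "y \<in> mball x r"
      using \<open>0 < r\<close> unfolding in_derived_set_of by (metis centre_in_mball_iff openin_mball)
    then show False
      using disc[of x y] by auto
  qed
  then show ?thesis
    using K discrete_compactin_eq_finite[of K mtopology] by (simp add: mtopology_of_def)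
qed

section \<open>Entropy of finite sets\<close>

lemma sep_le_card:
  assumes "finite K"
  shows "sep Z S n \<epsilon> K \<le> card K"
proof -
  let ?C = "{card E |E. finite E \<and> E \<subseteq> K \<and> dyn_separated Z S n \<epsilon> E}"
  have "?C \<subseteq> {..card K}"
    using assms by (auto intro: card_mono)
  \<comment> \<open>The empty set is vacuously separated, so the maximum ranges over a nonempty
    set.\<close>
  moreover have "0 \<in> ?C"
    by (force simp: dyn_separated_def)
  ultimately show ?thesis
    unfolding sep_def by (subst Max_le_iff) (auto intro: finite_subset card_mono assms)
qed

text \<open>The logarithm of \<open>sep\<close> lies between 0 and a constant independent of
  \<open>n\<close>, so division by \<open>n\<close> sends it to 0 for every
  \<open>\<epsilon>\<close>.\<close>

lemma top_entropy_on_finite: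
  assumes "finite K"
  shows "top_entropy_on Z S K = 0"
proof -
  have "limsup (\<lambda>n. ereal (1 / real n * ln (real (sep Z S n \<epsilon> K)))) = 0" for \<epsilon>
  proof -
    let ?f = "\<lambda>n. 1 / real n * ln (real (sep Z S n \<epsilon> K))"
    \<comment> \<open>The summand 1 keeps the argument positive even for empty \<open>K\<close>;
      when \<open>sep\<close> is 0, both bounds rest on the convention
      \<open>ln 0 = 0\<close>.\<close>
    have le: "ln (real (sep Z S n \<epsilon> K)) \<le> ln (1 + real (card K))"
      "0 \<le> ln (real (sep Z S n \<epsilon> K))" for n
    proof -
      show "0 \<le> ln (real (sep Z S n \<epsilon> K))"
        by (cases "sep Z S n \<epsilon> K") auto
      show "ln (real (sep Z S n \<epsilon> K)) \<le> ln (1 + real (card K))"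
      proof (cases "sep Z S n \<epsilon> K = 0")
        case False
        then show ?thesis
          using sep_le_card[OF assms, of Z S n \<epsilon>] by (intro ln_mono) auto
      qed auto
    qed
    have "(\<lambda>n. ln (1 + real (card K)) * (1 / real n)) \<longlonglongrightarrow> 0"
      using tendsto_mult_right_zero[OF lim_1_over_n] .
    then have "?f \<longlonglongrightarrow> 0"
      by (rule tendsto_sandwich[OF _ _ tendsto_const, rotated -1])
        (auto intro!: always_eventually divide_right_mono le divide_nonneg_nonneg)
    then have "(\<lambda>n. ereal (?f n)) \<longlonglongrightarrow> ereal 0"
      by (intro tendsto_ereal)
    then show ?thesis
      using lim_imp_Limsup[of sequentially "\<lambda>n. ereal (?f n)" "ereal 0"] by (simp add: zero_ereal_def)
  qed
  then show ?thesis
    unfolding top_entropy_on_def by (simp add: tendsto_Lim)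
qed

section \<open>The homeomorphism group of a compact metric space\<close>

locale compact_metric =
  fixes X :: "'a metric"
  assumes compact: "compact_space (mtopology_of X)"
begin

abbreviation H :: "('a \<Rightarrow> 'a) set"
  where "H \<equiv> mspace (homeo_space X)"

abbreviation \<rho> :: "('a \<Rightarrow> 'a) \<Rightarrow> ('a \<Rightarrow> 'a) \<Rightarrow> real"
  where "\<rho> \<equiv> mdist (homeo_space X)"

text \<open>The restriction makes the inverse extensional, as membership in \<open>H\<close>
  demands.\<close>

definition homeo_inv :: "('a \<Rightarrow> 'a) \<Rightarrow> 'a \<Rightarrow> 'a"
  where "homeo_inv f = restrict (inv_into (mspace X) f) (mspace X)"

sublocale base: Metric_space "mspace X" "mdist X"
  by (rule Metric_space_mspace_mdist)

sublocale homeo: Metric_space H \<rho>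
  by (rule Metric_space_mspace_mdist)

text \<open>Limits of homeomorphisms are first taken in this larger space, before they are known to
  be invertible.\<close>

sublocale cfun: Metric_space "mspace (cfunspace (mtopology_of X) X)" "mdist (cfunspace (mtopology_of X) X)"
  by (rule Metric_space_mspace_mdist)

lemma homeo_space_eq:
  "H = {f \<in> extensional (mspace X). homeomorphic_map (mtopology_of X) (mtopology_of X) f}"
  by (rule mspace_homeo_space[OF compact])

lemma homeo_in_cfunspace: "f \<in> H \<Longrightarrow> f \<in> mspace (cfunspace (mtopology_of X) X)"
  by (simp add: homeo_space_def)

lemma dist_eq_cfunspace: "\<rho> = mdist (cfunspace (mtopology_of X) X)"
  by (simp add: homeo_space_def)

lemma homeo_ext: "f \<in> H \<Longrightarrow> f \<in> extensional (mspace X)"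
  by (simp add: homeo_space_eq)

lemma homeo_in [simp]: "\<lbrakk>f \<in> H; x \<in> mspace X\<rbrakk> \<Longrightarrow> f x \<in> mspace X"
  by (auto simp: homeo_space_def)

lemma dist_point_le: "\<lbrakk>f \<in> H; g \<in> H; x \<in> mspace X\<rbrakk> \<Longrightarrow> mdist X (f x) (g x) \<le> \<rho> f g"
  unfolding dist_eq_cfunspace
  by (rule mdist_cfunspace_imp_mdist_le[OF homeo_in_cfunspace homeo_in_cfunspace order_refl]) auto

text \<open>The condition \<open>0 \<le> B\<close> covers the empty space, where the pointwise
  bounds say nothing.\<close>

lemma dist_leI: "\<lbrakk>0 \<le> B; \<And>x. x \<in> mspace X \<Longrightarrow> mdist X (f x) (g x) \<le> B\<rbrakk> \<Longrightarrow> \<rho> f g \<le> B"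
  unfolding dist_eq_cfunspace by (rule mdist_cfunspace_le) auto

lemma cfunspace_point_less:
  assumes "f \<in> mspace (cfunspace (mtopology_of X) X)" "g \<in> mspace (cfunspace (mtopology_of X) X)"
    and "mdist (cfunspace (mtopology_of X) X) f g < e" "x \<in> mspace X"
  shows "mdist X (f x) (g x) < e"
  using mdist_cfunspace_imp_mdist_le[OF assms(1,2) order_refl, of x] assms(3,4)
  by (simp del: mspace_cfunspace)

lemma homeoI:
  assumes "f \<in> extensional (mspace X)" "continuous_map (mtopology_of X) (mtopology_of X) f"
    "continuous_map (mtopology_of X) (mtopology_of X) g"
    "\<And>x. x \<in> mspace X \<Longrightarrow> f (g x) = x" "\<And>x. x \<in> mspace X \<Longrightarrow> g (f x) = x"
  shows "f \<in> H"
  using assms by (auto simp: homeo_space_eq homeomorphic_map_maps homeomorphic_maps_def)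

lemma homeo_continuous: "f \<in> H \<Longrightarrow> continuous_map (mtopology_of X) (mtopology_of X) f"
  by (simp add: homeo_space_eq homeomorphic_imp_continuous_map)

lemma homeo_inj: "f \<in> H \<Longrightarrow> inj_on f (mspace X)"
  using homeomorphic_imp_injective_map by (force simp: homeo_space_eq)

lemma homeo_image: "f \<in> H \<Longrightarrow> f ` mspace X = mspace X"
  using homeomorphic_imp_surjective_map by (force simp: homeo_space_eq)

text \<open>Injectivity of \<open>f\<close> makes a right inverse unique on the carrier, and
  extensionality turns this into equality of functions. It serves to recognise inverses of limits
  and of composites.\<close>

lemma homeo_inv_eq:
  assumes "f \<in> H" "g \<in> extensional (mspace X)" "\<And>x. x \<in> mspace X \<Longrightarrow> g x \<in> mspace X"
    "\<And>x. x \<in> mspace X \<Longrightarrow> f (g x) = x"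
  shows "homeo_inv f = g"
proof (rule extensionalityI[OF _ assms(2)])
  show "homeo_inv f \<in> extensional (mspace X)"
    by (simp add: homeo_inv_def)
  show "homeo_inv f x = g x" if "x \<in> mspace X" for x
    using that assms homeo_inj[OF assms(1)] by (auto simp: homeo_inv_def intro: inv_into_f_eq)
qed

lemma homeo_inv [simp]:
  assumes "f \<in> H"
  shows "homeo_inv f \<in> H"
    and "x \<in> mspace X \<Longrightarrow> f (homeo_inv f x) = x"
    and "x \<in> mspace X \<Longrightarrow> homeo_inv f (f x) = x"
proof -
  show r: "f (homeo_inv f x) = x" if "x \<in> mspace X" for x
    using that homeo_image[OF assms] by (simp add: homeo_inv_def f_inv_into_f)
  show l: "homeo_inv f (f x) = x" if "x \<in> mspace X" for x
    using that homeo_inj[OF assms] assms by (simp add: homeo_inv_def)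
  \<comment> \<open>\<open>inv_into\<close> by itself says nothing about continuity, which is
    therefore transferred from a continuous inverse \<open>g\<close> agreeing with it on the
    carrier.\<close>
  obtain g where g: "homeomorphic_maps (mtopology_of X) (mtopology_of X) f g"
    using assms by (auto simp: homeo_space_eq homeomorphic_map_maps)
  have "homeo_inv f x = g x" if "x \<in> mspace X" for x
    using that g homeo_inj[OF assms]
    by (auto simp: homeo_inv_def homeomorphic_maps_def continuous_map_def intro!: inv_into_f_eq)
  then have "continuous_map (mtopology_of X) (mtopology_of X) (homeo_inv f)"
    using g continuous_map_eq[of "mtopology_of X" "mtopology_of X" g "homeo_inv f"]
    by (simp add: homeomorphic_maps_def)
  then show "homeo_inv f \<in> H"
    using homeoI[of "homeo_inv f" f] r l homeo_continuous[OF assms] by (simp add: homeo_inv_def)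
qed

lemma homeo_compose [simp]:
  assumes "f \<in> H" "g \<in> H"
  shows "compose (mspace X) f g \<in> H"
proof -
  have "homeomorphic_map (mtopology_of X) (mtopology_of X) (f \<circ> g)"
    using assms by (intro homeomorphic_map_compose) (auto simp: homeo_space_eq)
  then have "homeomorphic_map (mtopology_of X) (mtopology_of X) (compose (mspace X) f g)"
    by (rule homeomorphic_map_eq) (simp add: compose_def)
  then show ?thesis
    by (simp add: homeo_space_eq)
qed

lemma homeo_id [simp]: "restrict id (mspace X) \<in> H"
proof -
  have "homeomorphic_map (mtopology_of X) (mtopology_of X) (restrict id (mspace X))"
    by (rule homeomorphic_map_eq[of _ _ id]) auto
  then show ?thesis
    by (simp add: homeo_space_eq)
qed

text \<open>The value at \<open>x\<close> after translation is the value of the original pair at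
  \<open>h x\<close>, so no new distances occur.\<close>

lemma dist_right_translate_le:
  assumes "f \<in> H" "g \<in> H" "h \<in> H"
  shows "\<rho> (compose (mspace X) f h) (compose (mspace X) g h) \<le> \<rho> f g"
  using assms by (intro dist_leI) (auto simp: compose_def intro: dist_point_le)

text \<open>Right translation by \<open>\<phi>\<inverse>\<close> carries the pair \<open>(\<phi>, id)\<close> to \<open>(id, \<phi>\<inverse>)\<close>.\<close>
lemma dist_homeo_inv_id_le:
  assumes "\<phi> \<in> H"
  shows "\<rho> (homeo_inv \<phi>) (restrict id (mspace X)) \<le> \<rho> \<phi> (restrict id (mspace X))"
proof (rule dist_leI)
  fix x assume x: "x \<in> mspace X"
  with assms have y: "homeo_inv \<phi> x \<in> mspace X" by simp
  show "mdist X (homeo_inv \<phi> x) (restrict id (mspace X) x) \<le> \<rho> \<phi> (restrict id (mspace X))"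
    using dist_point_le[OF assms homeo_id y] assms x y by (simp add: base.commute)
qed simp

section \<open>A complete metric on the homeomorphism group\<close>

text \<open>A uniform limit of homeomorphisms can fail to be injective, so \<open>\<rho>\<close> is
  in general not complete. The second term forces the inverses to converge too.\<close>

definition sym_dist :: "('a \<Rightarrow> 'a) \<Rightarrow> ('a \<Rightarrow> 'a) \<Rightarrow> real"
  where "sym_dist f g = \<rho> f g + \<rho> (homeo_inv f) (homeo_inv g)"

sublocale sym: Metric_space H sym_dist
proof
  show "0 \<le> sym_dist f g" for f g
    by (simp add: sym_dist_def)
  show "sym_dist f g = sym_dist g f" for f g
    by (simp add: sym_dist_def homeo.commute)
  show "sym_dist f g = 0 \<longleftrightarrow> f = g" if "f \<in> H" "g \<in> H" for f g
    using that by (auto simp: sym_dist_def add_nonneg_eq_0_iff)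
  show "sym_dist f h \<le> sym_dist f g + sym_dist g h" if "f \<in> H" "g \<in> H" "h \<in> H" for f g h
    using that homeo.triangle[of f g h] homeo.triangle[of "homeo_inv f" "homeo_inv g" "homeo_inv h"]
    by (simp add: sym_dist_def)
qed

text \<open>Compactness makes \<open>X\<close> complete, hence also the space of continuous maps. It
  is applied to a sequence and to its inverses separately.\<close>

lemma MCauchy_cfunspace_convergent:
  fixes s :: "nat \<Rightarrow> 'a \<Rightarrow> 'a"
  assumes "\<And>n. s n \<in> H" and "\<And>e. 0 < e \<Longrightarrow> \<exists>N. \<forall>n\<ge>N. \<forall>n'\<ge>N. \<rho> (s n) (s n') < e"
  obtains f where "f \<in> mspace (cfunspace (mtopology_of X) X)"
    "\<And>e. 0 < e \<Longrightarrow> \<exists>N. \<forall>n\<ge>N. mdist (cfunspace (mtopology_of X) X) (s n) f < e"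
proof -
  have "base.mcomplete"
    using compact base.compact_space_imp_mcomplete by (simp add: mtopology_of_def)
  then have "cfun.mcomplete"
    using base.mcomplete_cfunspace[of "mtopology_of X"] by (simp add: mcomplete_of_def Metric_space.Self_def)
  moreover have "cfun.MCauchy s"
    unfolding cfun.MCauchy_def unfolding dist_eq_cfunspace[symmetric]
  proof (intro conjI strip)
    show "range s \<subseteq> mspace (cfunspace (mtopology_of X) X)"
      using assms(1) homeo_in_cfunspace by (simp add: image_subset_iff del: mspace_cfunspace)
    show "\<exists>N. \<forall>n n'. N \<le> n \<longrightarrow> N \<le> n' \<longrightarrow> \<rho> (s n) (s n') < e" if "0 < e" for e
      using assms(2)[OF that] by simp
  qed
  ultimately obtain f where "limitin cfun.mtopology s f sequentially"
    unfolding cfun.mcomplete_def by blast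
  then have "f \<in> mspace (cfunspace (mtopology_of X) X)"
    "\<forall>e>0. \<exists>N. \<forall>n\<ge>N. s n \<in> mspace (cfunspace (mtopology_of X) X) \<and> mdist (cfunspace (mtopology_of X) X) (s n) f < e"
    unfolding cfun.limit_metric_sequentially by (rule conjunct1, rule conjunct2)
  then show thesis
    by (intro that) (assumption, blast)
qed

text \<open>Both identities arise by passing to the limit in the equations saying that
  \<open>s n\<close> and \<open>homeo_inv (s n)\<close> are mutually inverse.\<close>

lemma uniform_limit_compose_eq_id:
  fixes s :: "nat \<Rightarrow> 'a \<Rightarrow> 'a"
  assumes f: "f \<in> mspace (cfunspace (mtopology_of X) X)" and g: "g \<in> mspace (cfunspace (mtopology_of X) X)"
    and s: "\<And>n. s n \<in> H"
    and lf: "\<And>e. 0 < e \<Longrightarrow> \<exists>N. \<forall>n\<ge>N. mdist (cfunspace (mtopology_of X) X) (s n) f < e"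
    and lg: "\<And>e. 0 < e \<Longrightarrow> \<exists>N. \<forall>n\<ge>N. mdist (cfunspace (mtopology_of X) X) (homeo_inv (s n)) g < e"
    and x: "x \<in> mspace X"
  shows "f (g x) = x" "g (f x) = x"
proof -
  \<comment> \<open>One claim for a sequence \<open>s\<close> and right inverses \<open>t\<close> at
    \<open>x\<close> yields both identities, by exchanging the two sequences.\<close>
  have key: "f (g x) = x"
    if f: "f \<in> mspace (cfunspace (mtopology_of X) X)" and g: "g \<in> mspace (cfunspace (mtopology_of X) X)"
      and s: "\<And>n. s n \<in> H" "\<And>n. t n \<in> H" "\<And>n. s n (t n x) = x"
      and lf: "\<And>e. 0 < e \<Longrightarrow> \<exists>N. \<forall>n\<ge>N. mdist (cfunspace (mtopology_of X) X) (s n) f < e"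
      and lg: "\<And>e. 0 < e \<Longrightarrow> \<exists>N. \<forall>n\<ge>N. mdist (cfunspace (mtopology_of X) X) (t n) g < e"
    for f g and s t :: "nat \<Rightarrow> 'a \<Rightarrow> 'a"
  proof -
    have in_X: "f y \<in> mspace X" "g y \<in> mspace X" if "y \<in> mspace X" for y
      using f g that by auto
    have uf: "uniformly_continuous_map X X f"
      using f by (simp flip: continuous_eq_uniformly_continuous_map[OF compact])
    have "mdist X (f (g x)) x < 2 * e" if e: "0 < e" for e
    proof -
      obtain \<delta> where \<delta>: "0 < \<delta>"
        "\<And>y z. \<lbrakk>y \<in> mspace X; z \<in> mspace X; mdist X z y < \<delta>\<rbrakk> \<Longrightarrow> mdist X (f z) (f y) < e"
        using uf e unfolding uniformly_continuous_map_def by meson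
      obtain N1 where N1: "\<forall>n\<ge>N1. mdist (cfunspace (mtopology_of X) X) (s n) f < e"
        using lf e by blast
      obtain N2 where N2: "\<forall>n\<ge>N2. mdist (cfunspace (mtopology_of X) X) (t n) g < \<delta>"
        using lg \<delta>(1) by blast
      define n where "n = max N1 N2"
      have tx: "t n x \<in> mspace X" using s x by simp
      have "mdist X (t n x) (g x) < \<delta>"
        by (rule cfunspace_point_less[OF homeo_in_cfunspace[OF s(2)] g _ x]) (simp add: N2 n_def)
      then have 1: "mdist X (f (t n x)) (f (g x)) < e"
        using \<delta>(2) tx in_X x by blast
      \<comment> \<open>The point \<open>t n x\<close> moves with \<open>n\<close>, so pointwise
        convergence of \<open>s\<close> would not suffice here.\<close>
      have "mdist X (s n (t n x)) (f (t n x)) < e"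
        by (rule cfunspace_point_less[OF homeo_in_cfunspace[OF s(1)] f _ tx]) (simp add: N1 n_def)
      then have 2: "mdist X x (f (t n x)) < e"
        using s(3) by simp
      show ?thesis
        using base.triangle[of x "f (t n x)" "f (g x)"] 1 2 x tx in_X by (simp add: base.commute)
    qed
    \<comment> \<open>With \<open>e\<close> half the distance, a positive distance would be less
      than itself.\<close>
    from this[of "mdist X (f (g x)) x / 2"] show ?thesis
      using in_X x base.mdist_pos_less[of "f (g x)" x] by fastforce
  qed
  show "f (g x) = x"
    by (rule key[of f g s "\<lambda>n. homeo_inv (s n)"]) (use assms in auto)
  show "g (f x) = x"
    by (rule key[of g f "\<lambda>n. homeo_inv (s n)" s]) (use assms in auto)
qed

text \<open>The sequence and its inverses converge uniformly to continuous maps \<open>f\<close> and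
  \<open>g\<close>. These are mutually inverse, so \<open>f\<close> is a homeomorphism and
  \<open>g\<close> is its inverse, which gives convergence in both terms of
  \<open>sym_dist\<close>.\<close>

lemma mcomplete_sym_dist: "sym.mcomplete"
  unfolding sym.mcomplete_def
proof (intro allI impI)
  fix s assume C: "sym.MCauchy s"
  then have s: "s n \<in> H" for n
    by (auto simp: sym.MCauchy_def)
  have small: "\<rho> f g \<le> sym_dist f g" "\<rho> (homeo_inv f) (homeo_inv g) \<le> sym_dist f g" for f g
    by (simp_all add: sym_dist_def)
  have C1: "\<exists>N. \<forall>n\<ge>N. \<forall>n'\<ge>N. \<rho> (s n) (s n') < e"
    and C2: "\<exists>N. \<forall>n\<ge>N. \<forall>n'\<ge>N. \<rho> (homeo_inv (s n)) (homeo_inv (s n')) < e" if e: "0 < e" for e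
  proof -
    obtain N where N: "\<And>n n'. \<lbrakk>N \<le> n; N \<le> n'\<rbrakk> \<Longrightarrow> sym_dist (s n) (s n') < e"
      using C e unfolding sym.MCauchy_def by meson
    show "\<exists>N. \<forall>n\<ge>N. \<forall>n'\<ge>N. \<rho> (s n) (s n') < e"
      using N le_less_trans[OF small(1)] by (intro exI[of _ N]) simp
    show "\<exists>N. \<forall>n\<ge>N. \<forall>n'\<ge>N. \<rho> (homeo_inv (s n)) (homeo_inv (s n')) < e"
      using N le_less_trans[OF small(2)] by (intro exI[of _ N]) simp
  qed
  obtain f where f: "f \<in> mspace (cfunspace (mtopology_of X) X)"
    and lf: "\<And>e. 0 < e \<Longrightarrow> \<exists>N. \<forall>n\<ge>N. mdist (cfunspace (mtopology_of X) X) (s n) f < e"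
    using MCauchy_cfunspace_convergent[of s, OF s C1] by blast
  obtain g where g: "g \<in> mspace (cfunspace (mtopology_of X) X)"
    and lg: "\<And>e. 0 < e \<Longrightarrow> \<exists>N. \<forall>n\<ge>N. mdist (cfunspace (mtopology_of X) X) (homeo_inv (s n)) g < e"
    using MCauchy_cfunspace_convergent[of "\<lambda>n. homeo_inv (s n)", OF homeo_inv(1)[OF s] C2] by blast
  have fg: "f (g x) = x" "g (f x) = x" if "x \<in> mspace X" for x
    using uniform_limit_compose_eq_id[OF f g s lf lg that] by auto
  have fH: "f \<in> H"
    by (rule homeoI[of f g]) (use f g fg in auto)
  have "homeo_inv f = g"
    by (rule homeo_inv_eq[OF fH]) (use g fg in auto)
  have "\<exists>N. \<forall>n\<ge>N. sym_dist (s n) f < e" if e: "0 < e" for e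
  proof -
    obtain N1 N2 where "\<forall>n\<ge>N1. \<rho> (s n) f < e/2" "\<forall>n\<ge>N2. \<rho> (homeo_inv (s n)) g < e/2"
      using lf[of "e/2"] lg[of "e/2"] e unfolding dist_eq_cfunspace by auto
    then have "\<forall>n\<ge>max N1 N2. sym_dist (s n) f < e"
      using \<open>homeo_inv f = g\<close> by (fastforce simp: sym_dist_def)
    then show ?thesis ..
  qed
  then show "\<exists>f. limitin sym.mtopology s f sequentially"
    unfolding sym.limit_metric_sequentially by (intro exI[of _ f]) (simp add: fH s)
qed

section \<open>Uniform discreteness of a countable homeomorphism group\<close>

text \<open>Let \<open>f\<close> be isolated for \<open>sym_dist\<close>. If \<open>\<phi>\<close>
  is \<open>\<rho>\<close>-close to the identity, then \<open>f\<close> composed with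
  \<open>\<phi>\<close> is \<open>sym_dist\<close>-close to \<open>f\<close>, hence equal to it, and
  cancelling \<open>f\<close> leaves the identity.\<close>

lemma countable_imp_id_isolated:
  assumes "countable H"
  obtains r where "0 < r" "\<And>\<phi>. \<lbrakk>\<phi> \<in> H; \<rho> \<phi> (restrict id (mspace X)) < r\<rbrakk> \<Longrightarrow> \<phi> = restrict id (mspace X)"
proof -
  let ?id = "restrict id (mspace X)"
  have "H \<noteq> {}"
    using homeo_id by blast
  then obtain f \<epsilon> where f: "f \<in> H" and "0 < \<epsilon>" and iso: "\<And>h. \<lbrakk>h \<in> H; sym_dist f h < \<epsilon>\<rbrakk> \<Longrightarrow> h = f"
    using sym.countable_mcomplete_isolated_point[OF mcomplete_sym_dist assms] by meson
  have uf: "uniformly_continuous_map X X f"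
    using homeo_continuous[OF f] by (simp add: continuous_eq_uniformly_continuous_map[OF compact])
  have "0 < \<epsilon>/2"
    using \<open>0 < \<epsilon>\<close> by simp
  then obtain \<delta> where \<delta>: "0 < \<delta>"
    "\<And>y z. \<lbrakk>y \<in> mspace X; z \<in> mspace X; mdist X z y < \<delta>\<rbrakk> \<Longrightarrow> mdist X (f z) (f y) < \<epsilon>/2"
    using uf unfolding uniformly_continuous_map_def by meson
  \<comment> \<open>The bound \<open>\<delta>\<close> controls the maps through uniform continuity
    of \<open>f\<close>; the bound \<open>\<epsilon>/2\<close> controls the inverses and supplies
    the strict inequality in the sum.\<close>
  have "\<phi> = ?id" if \<phi>: "\<phi> \<in> H" and lt: "\<rho> \<phi> ?id < min \<delta> (\<epsilon>/2)" for \<phi>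
  proof -
    let ?h = "compose (mspace X) f \<phi>" and ?k = "compose (mspace X) (homeo_inv \<phi>) (homeo_inv f)"
    have h: "?h \<in> H"
      using f \<phi> by simp
    have k: "homeo_inv ?h = ?k"
      by (rule homeo_inv_eq[OF h]) (use f \<phi> in \<open>auto simp: compose_def\<close>)
    have "\<rho> f ?h \<le> \<epsilon>/2"
    proof (rule dist_leI)
      fix x assume x: "x \<in> mspace X"
      have "mdist X (\<phi> x) x < \<delta>"
        using dist_point_le[OF \<phi> homeo_id x] lt x by simp
      then show "mdist X (f x) (?h x) \<le> \<epsilon>/2"
        using \<delta>(2)[of x "\<phi> x"] \<phi> x by (simp add: compose_def base.commute)
    qed (use \<open>0 < \<epsilon>\<close> in simp)
    \<comment> \<open>This exhibits \<open>?k\<close> and \<open>homeo_inv f\<close> as right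
      translates, by the same map, of \<open>homeo_inv \<phi>\<close> and the identity.\<close>
    moreover have "compose (mspace X) ?id (homeo_inv f) = homeo_inv f"
      using homeo_inv(1)[OF f]
      by (intro extensionalityI[of _ "mspace X"]) (auto simp: compose_def intro: homeo_ext)
    then have "\<rho> ?k (homeo_inv f) \<le> \<rho> \<phi> ?id"
      using dist_right_translate_le[of "homeo_inv \<phi>" ?id "homeo_inv f"] dist_homeo_inv_id_le[OF \<phi>] f \<phi>
      by simp
    ultimately have "sym_dist f ?h < \<epsilon>"
      using lt k by (simp add: sym_dist_def homeo.commute)
    then have eq: "?h = f"
      using iso h by blast
    show ?thesis
    proof (rule extensionalityI[OF homeo_ext[OF \<phi>] homeo_ext[OF homeo_id]])
      fix x assume x: "x \<in> mspace X"
      have "f (\<phi> x) = f x"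
        using fun_cong[OF eq, of x] x by (simp add: compose_def)
      then show "\<phi> x = ?id x"
        using inj_onD[OF homeo_inj[OF f], of "\<phi> x" x] \<phi> x by simp
    qed
  qed
  then show thesis
    using that[of "min \<delta> (\<epsilon>/2)"] \<open>0 < \<delta>\<close> \<open>0 < \<epsilon>\<close> by simp
qed

text \<open>Right translation by the inverse of \<open>\<psi>\<close> moves \<open>\<psi>\<close> to
  the identity without increasing distances, so the radius at the identity works at every
  point.\<close>

lemma countable_imp_uniformly_discrete:
  assumes "countable H"
  obtains r where "0 < r" "\<And>\<phi> \<psi>. \<lbrakk>\<phi> \<in> H; \<psi> \<in> H; \<rho> \<phi> \<psi> < r\<rbrakk> \<Longrightarrow> \<phi> = \<psi>"
proof -
  let ?id = "restrict id (mspace X)"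
  obtain r where r: "0 < r" "\<And>\<phi>. \<lbrakk>\<phi> \<in> H; \<rho> \<phi> ?id < r\<rbrakk> \<Longrightarrow> \<phi> = ?id"
    using countable_imp_id_isolated[OF assms] by blast
  have "\<phi> = \<psi>" if H: "\<phi> \<in> H" "\<psi> \<in> H" and lt: "\<rho> \<phi> \<psi> < r" for \<phi> \<psi>
  proof -
    let ?\<theta> = "compose (mspace X) \<phi> (homeo_inv \<psi>)"
    have "compose (mspace X) \<psi> (homeo_inv \<psi>) = ?id"
      using H by (intro extensionalityI[of _ "mspace X"]) (auto simp: compose_def)
    then have "?\<theta> = ?id"
      using r(2)[of ?\<theta>] dist_right_translate_le[of \<phi> \<psi> "homeo_inv \<psi>"] H lt by simp
    show ?thesis
    proof (rule extensionalityI[OF homeo_ext[OF H(1)] homeo_ext[OF H(2)]])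
      fix x assume x: "x \<in> mspace X"
      then show "\<phi> x = \<psi> x"
        using fun_cong[OF \<open>?\<theta> = ?id\<close>, of "\<psi> x"] H by (simp add: compose_def)
    qed
  qed
  with r(1) show thesis
    using that by blast
qed

end

theorem proposition2:
  fixes X :: "'a metric" and T :: "'a \<Rightarrow> 'a"
  assumes "compact_space (mtopology_of X)"
    and "countable (mspace (homeo_space X))"
    and "T \<in> mspace (homeo_space X)"
  shows "top_entropy (homeo_space X) (left_comp X T) = 0"
proof -
  interpret compact_metric X
    by unfold_locales (rule assms(1))
  obtain r where r: "0 < r" "\<And>\<phi> \<psi>. \<lbrakk>\<phi> \<in> H; \<psi> \<in> H; \<rho> \<phi> \<psi> < r\<rbrakk> \<Longrightarrow> \<phi> = \<psi>"
    using countable_imp_uniformly_discrete[OF assms(2)] by blast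
  have "top_entropy_on (homeo_space X) (left_comp X T) K = 0"
    if "compactin (mtopology_of (homeo_space X)) K" for K
    using compactin_uniformly_discrete_imp_finite[OF that r] by (rule top_entropy_on_finite)
  \<comment> \<open>The empty set is compact; over no compact sets at all the supremum would be
    minus infinity instead of 0.\<close>
  moreover have "{K. compactin (mtopology_of (homeo_space X)) K} \<noteq> {}"
    by blast
  ultimately show ?thesis
    unfolding top_entropy_def by (intro SUP_eq_const) auto
qed

end
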